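(* Let $n\geq l\geq 3$ be integers. If $G$ is an $n$-vertex unicyclic graph with girth $l$, then for every integer $k\geq 0$, $$n_k(US_n^l)\geq n_k(G)\geq n_k(UP_n^l).$$
   Context: A unicyclic graph is a connected graph containing exactly one cycle; its girth is the length of that cycle. A subtree of a graph $G$ is a subgraph of $G$ that is a tree (subtrees are distinguished as subgraphs); $n_k(G)$ is the number of subtrees of $G$ with exactly $k$ vertices, with the convention $n_0(G)=1$. $US_n^l$ is the graph obtained from the cycle $C_l$ by attaching $n-l$ pendent vertices to one vertex of the cycle. $UP_n^l$ is the graph obtained from $C_l$ by attaching a pendent path of length $n-l$ (i.e. with $n-l$ new vertices) to one vertex of the cycle. *)

theory Defs
  imports Main
begin

definition graph :: "'a set \<Rightarrow> 'a set set \<Rightarrow> bool" where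
  "graph V E \<longleftrightarrow> finite V \<and> (\<forall>e\<in>E. \<exists>u v. u \<noteq> v \<and> u \<in> V \<and> v \<in> V \<and> e = {u, v})"

definition adj :: "'a set set \<Rightarrow> 'a \<Rightarrow> 'a \<Rightarrow> bool" where
  "adj E u v \<longleftrightarrow> u \<noteq> v \<and> {u, v} \<in> E"

definition connected_graph :: "'a set \<Rightarrow> 'a set set \<Rightarrow> bool" where
  "connected_graph V E \<longleftrightarrow> V \<noteq> {} \<and> (\<forall>u\<in>V. \<forall>v\<in>V. (adj E)\<^sup>*\<^sup>* u v)"

definition is_cycle :: "'a set set \<Rightarrow> bool" where
  "is_cycle C \<longleftrightarrow> finite (\<Union>C) \<and> graph (\<Union>C) C \<and> card (\<Union>C) \<ge> 3 \<and>
     connected_graph (\<Union>C) C \<and> (\<forall>w\<in>\<Union>C. card {e\<in>C. w \<in> e} = 2)"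

definition cycles :: "'a set \<Rightarrow> 'a set set \<Rightarrow> 'a set set set" where
  "cycles V E = {C. C \<subseteq> E \<and> is_cycle C}"

definition is_tree :: "'a set \<Rightarrow> 'a set set \<Rightarrow> bool" where
  "is_tree V E \<longleftrightarrow> graph V E \<and> connected_graph V E \<and> cycles V E = {}"

definition unicyclic :: "'a set \<Rightarrow> 'a set set \<Rightarrow> bool" where
  "unicyclic V E \<longleftrightarrow> graph V E \<and> connected_graph V E \<and> card (cycles V E) = 1"

definition has_girth :: "'a set \<Rightarrow> 'a set set \<Rightarrow> nat \<Rightarrow> bool" where
  "has_girth V E l \<longleftrightarrow> (\<exists>C. cycles V E = {C} \<and> card C = l)"

definition subtrees :: "'a set \<Rightarrow> 'a set set \<Rightarrow> ('a set \<times> 'a set set) set" where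
  "subtrees V E = {(V', E'). V' \<subseteq> V \<and> E' \<subseteq> E \<and> is_tree V' E'}"

definition nsub :: "nat \<Rightarrow> 'a set \<Rightarrow> 'a set set \<Rightarrow> nat" where
  "nsub k V E = (if k = 0 then 1 else card {T \<in> subtrees V E. card (fst T) = k})"

text \<open>Concrete graphs on vertex set {0..<n}: the cycle C_l is 0,1,...,l-1,0;
US_n^l attaches pendant vertices l,...,n-1 to vertex 0;
UP_n^l attaches the path 0 - l - (l+1) - ... - (n-1) to vertex 0.\<close>

definition cycle_edges :: "nat \<Rightarrow> nat set set" where
  "cycle_edges l = {{i, (i + 1) mod l} | i. i < l}"

definition US_V :: "nat \<Rightarrow> nat \<Rightarrow> nat set" where "US_V n l = {0..<n}"
definition US_E :: "nat \<Rightarrow> nat \<Rightarrow> nat set set" where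
  "US_E n l = cycle_edges l \<union> {{0, j} | j. l \<le> j \<and> j < n}"

definition UP_V :: "nat \<Rightarrow> nat \<Rightarrow> nat set" where "UP_V n l = {0..<n}"
definition UP_E :: "nat \<Rightarrow> nat \<Rightarrow> nat set set" where
  "UP_E n l = cycle_edges l \<union> (if l < n then {{0, l}} else {})
     \<union> {{j, j + 1} | j. l \<le> j \<and> j + 1 < n}"

end

theory Submission
  imports Defs
begin

text \<open>A tree is grown from a vertex, and a unicyclic graph from its cycle, by attaching leaves. If
  \<open>H\<close> arises from \<open>G\<close> by attaching a leaf \<open>w\<close> to \<open>u\<close>, the \<open>(k+1)\<close>-vertex subtrees of \<open>H\<close> are those
  of \<open>G\<close> together with those through \<open>w\<close>, which for \<open>k > 0\<close> correspond to the \<open>k\<close>-vertex subtrees of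
  \<open>G\<close> through \<open>u\<close>. So it suffices to show that the number of \<open>k\<close>-vertex subtrees through a
  vertex, over all vertices of all unicyclic graphs with \<open>n\<close> vertices and girth \<open>l\<close>, is largest at the
  centre of \<open>US\<close> and smallest at the end of the tail of \<open>UP\<close>. Both follow by removing leaves again.
  The lower bound also uses that the number of \<open>k\<close>-vertex subtrees through the end of \<open>UP\<close> is
  nondecreasing in \<open>k \<le> n\<close>, which reduces to the same fact for a vertex of the cycle.\<close>

section \<open>Adjacency and connectedness\<close>

lemma adj_sym: "adj E u v \<Longrightarrow> adj E v u"
  by (auto simp: adj_def insert_commute)

lemma adj_rtranclp_sym: "(adj E)\<^sup>*\<^sup>* u v \<Longrightarrow> (adj E)\<^sup>*\<^sup>* v u"
  by (induction rule: rtranclp_induct) (auto intro: converse_rtranclp_into_rtranclp adj_sym)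

lemma adj_rtranclp_mono: "(adj E)\<^sup>*\<^sup>* u v \<Longrightarrow> E \<subseteq> F \<Longrightarrow> (adj F)\<^sup>*\<^sup>* u v"
  by (rule rtranclp_mono[THEN predicate2D, of "adj E"]) (auto simp: adj_def)

lemma graph_edgeE:
  assumes "graph V E" "e \<in> E"
  obtains u v where "u \<noteq> v" "u \<in> V" "v \<in> V" "e = {u, v}" "adj E u v"
  using assms unfolding graph_def adj_def by metis

lemma graph_edge_subset: "graph V E \<Longrightarrow> e \<in> E \<Longrightarrow> e \<subseteq> V"
  by (auto elim: graph_edgeE)

lemma graph_adj_in: "graph V E \<Longrightarrow> adj E u v \<Longrightarrow> u \<in> V \<and> v \<in> V"
  unfolding adj_def using graph_edge_subset by fastforce

lemma graph_subset:
  assumes "graph V E" "E' \<subseteq> E" "\<forall>e\<in>E'. e \<subseteq> V'" "V' \<subseteq> V"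
  shows "graph V' E'"
  unfolding graph_def
proof (intro conjI ballI)
  show "finite V'" using assms by (auto simp: graph_def intro: finite_subset)
  fix e assume e: "e \<in> E'"
  then obtain u v where "u \<noteq> v" "e = {u, v}" using assms graph_edgeE by (metis subsetD)
  then show "\<exists>u v. u \<noteq> v \<and> u \<in> V' \<and> v \<in> V' \<and> e = {u, v}"
    using assms(3) e by (intro exI[of _ u] exI[of _ v]) auto
qed

lemma graph_finite: "graph V E \<Longrightarrow> finite V \<and> finite E"
  by (auto simp: graph_def intro: finite_subset[of E "Pow V"])

lemma graph_image:
  assumes "graph V E" "inj_on f V"
  shows "graph (f ` V) ((`) f ` E)"
  unfolding graph_def
proof (intro conjI ballI)
  show "finite (f ` V)" using assms by (simp add: graph_def)
  fix e assume "e \<in> (`) f ` E"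
  then obtain e' where e': "e' \<in> E" "e = f ` e'" by auto
  from graph_edgeE[OF assms(1) e'(1)] obtain u v where "u \<noteq> v" "u \<in> V" "v \<in> V" "e' = {u, v}"
    by metis
  then show "\<exists>u v. u \<noteq> v \<and> u \<in> f ` V \<and> v \<in> f ` V \<and> e = {u, v}"
    using e' inj_on_eq_iff[OF assms(2)] by (intro exI[of _ "f u"] exI[of _ "f v"]) simp
qed

lemma connected_graph_insert:
  assumes "connected_graph V E" "u \<in> V" "w \<notin> V"
  shows "connected_graph (insert w V) (insert {u, w} E)"
proof -
  let ?E = "insert {u, w} E"
  have u: "(adj ?E)\<^sup>*\<^sup>* u x" if "x \<in> insert w V" for x
  proof (cases "x = w")
    case True
    then show ?thesis using assms by (auto simp: adj_def intro!: r_into_rtranclp)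
  next
    case False
    then have "(adj E)\<^sup>*\<^sup>* u x" using assms that by (auto simp: connected_graph_def)
    then show ?thesis by (rule adj_rtranclp_mono) auto
  qed
  then show ?thesis unfolding connected_graph_def
    by (metis adj_rtranclp_sym insert_not_empty rtranclp_trans)
qed

lemma connected_graph_mono: "connected_graph V E \<Longrightarrow> E \<subseteq> F \<Longrightarrow> connected_graph V F"
  unfolding connected_graph_def using adj_rtranclp_mono by metis

text \<open>A walk from a vertex of \<open>S\<close> to one outside must cross the boundary of
  \<open>S\<close> somewhere.\<close>

lemma connected_graph_leaving_edge:
  assumes "connected_graph V E" "S \<subset> V" "S \<noteq> {}" "graph V E"
  obtains x y where "x \<in> S" "y \<in> V - S" "adj E x y"
proof -
  obtain a b where ab: "a \<in> S" "b \<in> V - S" using assms by blast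
  then have "(adj E)\<^sup>*\<^sup>* a b" using assms unfolding connected_graph_def by blast
  then have "b \<in> S \<or> (\<exists>x y. x \<in> S \<and> y \<in> V - S \<and> adj E x y)"
    by (induction rule: rtranclp_induct) (use ab graph_adj_in[OF assms(4)] in blast)+
  with ab that show ?thesis by blast
qed

text \<open>Enlarge \<open>S\<close> one vertex at a time along leaving edges; connectedness is kept
  throughout, so the last vertex added can be removed without disconnecting the rest. Starting from
  a given \<open>S\<close> guarantees that this vertex lies outside it, which later keeps a cycle
  intact.\<close>

lemma non_cut_vertex_exists:
  assumes "graph V E" "connected_graph V E"
    and "S \<subset> V" "connected_graph S {e \<in> E. e \<subseteq> S}"
  shows "\<exists>w \<in> V - S. connected_graph (V - {w}) {e \<in> E. e \<subseteq> V - {w}}"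
  using assms(3,4)
proof (induction "card (V - S)" arbitrary: S rule: less_induct)
  case less
  have fin: "finite V" using assms graph_finite by blast
  have "S \<noteq> {}" using less by (auto simp: connected_graph_def)
  then obtain x y where xy: "x \<in> S" "y \<in> V - S" "adj E x y"
    using connected_graph_leaving_edge assms less by metis
  have c: "connected_graph (insert y S) {e \<in> E. e \<subseteq> insert y S}"
    by (rule connected_graph_mono[OF connected_graph_insert[OF less(3) xy(1)]])
      (use xy in \<open>auto simp: adj_def\<close>)
  show ?case
  proof (cases "insert y S = V")
    case True
    then have "S = V - {y}" using xy by auto
    then show ?thesis using less xy by auto
  next
    case False
    then have "insert y S \<subset> V" using xy less by auto
    moreover have "card (V - insert y S) < card (V - S)"
      using xy fin by (intro psubset_card_mono) auto
    ultimately show ?thesis using less(1)[OF _ _ c] by auto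
  qed
qed

section \<open>Cycles\<close>

lemma Suc_mod_if: "i < l \<Longrightarrow> Suc i mod l = (if Suc i = l then 0 else Suc i)"
  by auto

lemma Union_cycle_edges: "3 \<le> l \<Longrightarrow> \<Union>(cycle_edges l) = {0..<l}"
  unfolding cycle_edges_def
  by (auto simp: Suc_mod_if split: if_splits) (metis insertI1)

lemma graph_cycle_edges:
  assumes "3 \<le> l"
  shows "graph {0..<l} (cycle_edges l)"
  unfolding graph_def
proof (intro conjI ballI)
  fix e assume "e \<in> cycle_edges l"
  then obtain i where "i < l" "e = {i, Suc i mod l}" by (auto simp: cycle_edges_def)
  then show "\<exists>u v. u \<noteq> v \<and> u \<in> {0..<l} \<and> v \<in> {0..<l} \<and> e = {u, v}"
    using assms by (intro exI[of _ i] exI[of _ "Suc i mod l"]) (auto simp: Suc_mod_if)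
qed simp

lemma cycle_edge_inj:
  "3 \<le> l \<Longrightarrow> inj_on (\<lambda>i. {i, Suc i mod l}) {0..<l}"
  by (auto simp: inj_on_def doubleton_eq_iff Suc_mod_if split: if_splits)

lemma card_cycle_edges: "3 \<le> l \<Longrightarrow> card (cycle_edges l) = l"
proof -
  assume l: "3 \<le> l"
  have "cycle_edges l = (\<lambda>i. {i, Suc i mod l}) ` {0..<l}"
    by (auto simp: cycle_edges_def)
  then show ?thesis by (simp add: card_image cycle_edge_inj[OF l])
qed

lemma is_cycle_cycle_edges:
  assumes "3 \<le> l"
  shows "is_cycle (cycle_edges l)"
proof -
  have z: "(adj (cycle_edges l))\<^sup>*\<^sup>* 0 i" if "i < l" for i
    using that
  proof (induction i)
    case (Suc i)
    then have "adj (cycle_edges l) i (Suc i)"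
      by (auto simp: adj_def cycle_edges_def intro!: exI[of _ i])
    with Suc show ?case by (meson Suc_lessD rtranclp.rtrancl_into_rtrancl)
  qed simp
  have "connected_graph {0..<l} (cycle_edges l)"
    unfolding connected_graph_def using z assms
    by (auto intro!: rtranclp_trans[OF adj_rtranclp_sym[OF z] z])
  moreover have "card {e \<in> cycle_edges l. w \<in> e} = 2" if "w < l" for w
  proof -
    \<comment> \<open>\<open>p\<close> is the cyclic predecessor of \<open>w\<close>. Indexing each
      edge by its first endpoint, the edges at \<open>w\<close> are those with index
      \<open>w\<close> and \<open>p\<close>.\<close>
    define p where "p = (if w = 0 then l - 1 else w - 1)"
    have "{e \<in> cycle_edges l. w \<in> e} = (\<lambda>i. {i, Suc i mod l}) ` {w, p}"
      using that assms by (auto simp: cycle_edges_def p_def Suc_mod_if split: if_splits)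
    moreover have "card \<dots> = card {w, p}"
      by (intro card_image inj_on_subset[OF cycle_edge_inj[OF assms]])
        (use that assms in \<open>auto simp: p_def\<close>)
    moreover have "w \<noteq> p" using that assms by (auto simp: p_def)
    ultimately show ?thesis by simp
  qed
  ultimately show ?thesis
    unfolding is_cycle_def Union_cycle_edges[OF assms]
    using graph_cycle_edges[OF assms] assms by simp
qed

section \<open>Images of cycles, and cycles from closed paths\<close>

lemma adj_rtranclp_image:
  assumes "inj_on f (\<Union>C)" "(adj C)\<^sup>*\<^sup>* u v"
  shows "(adj ((`) f ` C))\<^sup>*\<^sup>* (f u) (f v)"
  using assms(2)
proof (induction rule: rtranclp_induct)
  case (step y z)
  have "f y \<noteq> f z" using step(2) assms(1) unfolding adj_def inj_on_def by blast
  moreover have "{f y, f z} \<in> (`) f ` C" using step(2) unfolding adj_def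
    by (metis image_empty image_insert image_eqI)
  ultimately have "adj ((`) f ` C) (f y) (f z)" by (simp add: adj_def)
  with step(3) show ?case by (rule rtranclp.rtrancl_into_rtrancl)
qed simp

lemma is_cycle_image:
  assumes "is_cycle C" "inj_on f (\<Union>C)"
  shows "is_cycle ((`) f ` C)"
proof -
  let ?D = "(`) f ` C"
  have U: "\<Union>?D = f ` \<Union>C" by auto
  have g: "graph (\<Union>C) C" using assms by (simp add: is_cycle_def)
  have "graph (f ` \<Union>C) ?D" by (rule graph_image[OF g assms(2)])
  moreover have "connected_graph (f ` \<Union>C) ?D"
    using assms(1) unfolding is_cycle_def connected_graph_def
    by (auto intro: adj_rtranclp_image[OF assms(2)])
  moreover have "card {e \<in> ?D. f w \<in> e} = 2" if "w \<in> \<Union>C" for w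
  proof -
    have "f w \<in> f ` e \<longleftrightarrow> w \<in> e" if "e \<in> C" for e
      using inj_on_image_mem_iff[OF assms(2) \<open>w \<in> \<Union>C\<close>, of e] that by auto
    then have "{e \<in> ?D. f w \<in> e} = (`) f ` {e \<in> C. w \<in> e}" by auto
    moreover have "inj_on ((`) f) {e \<in> C. w \<in> e}"
      by (rule inj_on_subset[OF inj_on_image_Pow[OF assms(2)]]) auto
    moreover have "card {e \<in> C. w \<in> e} = 2"
      using assms(1) that unfolding is_cycle_def by blast
    ultimately show ?thesis by (simp add: card_image)
  qed
  ultimately show ?thesis
    using assms unfolding is_cycle_def U by (simp add: card_image)
qed

text \<open>Loop erasure: if the next vertex already occurs on the path, the path is cut back to
  that occurrence.\<close>

lemma rtranclp_distinct_path:
  assumes "r\<^sup>*\<^sup>* x y"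
  shows "\<exists>xs. xs \<noteq> [] \<and> hd xs = x \<and> last xs = y \<and> distinct xs \<and> successively r xs"
  using assms
proof (induction rule: rtranclp_induct)
  case base
  show ?case by (intro exI[of _ "[x]"]) auto
next
  case (step y z)
  then obtain xs where xs: "xs \<noteq> []" "hd xs = x" "last xs = y" "distinct xs" "successively r xs"
    by blast
  show ?case
  proof (cases "z \<in> set xs")
    case False
    then show ?thesis using xs step(2)
      by (intro exI[of _ "xs @ [z]"]) (auto simp: successively_append_iff)
  next
    case True
    then obtain as bs where "xs = as @ z # bs" by (meson split_list)
    then show ?thesis using xs
      by (intro exI[of _ "as @ [z]"]) (auto simp: successively_append_iff hd_append)
  qed
qed

text \<open>The edges of the closed path are the image of the standard cycle under the indexing
  \<open>i\<close> to \<open>xs ! i\<close>, which is injective because \<open>xs\<close> is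
  distinct.\<close>

lemma closed_path_is_cycle:
  assumes "distinct xs" "3 \<le> length xs" "successively (adj E) xs" "adj E (last xs) (hd xs)"
  defines "D \<equiv> (`) ((!) xs) ` cycle_edges (length xs)"
  shows "is_cycle D" "D \<subseteq> E" "{last xs, hd xs} \<in> D"
proof -
  let ?l = "length xs"
  show "is_cycle D" unfolding D_def
    using assms by (intro is_cycle_image is_cycle_cycle_edges)
      (auto simp: Union_cycle_edges inj_on_def nth_eq_iff_index_eq)
  have "{xs ! i, xs ! (Suc i mod ?l)} \<in> E" if "i < ?l" for i
  proof (cases "Suc i = ?l")
    case True
    then have "i = ?l - 1" by simp
    moreover have "xs \<noteq> []" using assms(2) by auto
    ultimately show ?thesis using assms(4) True
      by (simp add: adj_def hd_conv_nth last_conv_nth)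
  next
    case False
    then show ?thesis using that assms(3)
      by (auto simp: successively_conv_nth adj_def)
  qed
  then show "D \<subseteq> E" by (auto simp: D_def cycle_edges_def)
  have "Suc (?l - 1) = ?l" using assms(2) by linarith
  then have "{?l - 1, 0} = {?l - 1, (?l - 1 + 1) mod ?l}" "?l - 1 < ?l" by simp_all
  then have "{?l - 1, 0} \<in> cycle_edges ?l" unfolding cycle_edges_def by blast
  then have "(!) xs ` {?l - 1, 0} \<in> D" unfolding D_def by blast
  moreover have "xs \<noteq> []" using assms(2) by auto
  ultimately show "{last xs, hd xs} \<in> D" by (simp add: hd_conv_nth last_conv_nth)
qed

text \<open>A simple path from \<open>x\<close> to \<open>y\<close> that avoids the edge
  \<open>{x, y}\<close> has at least three vertices, so the edge closes it to a cycle. This is how a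
  surplus edge is turned into a forbidden cycle below.\<close>

lemma edge_in_cycle:
  assumes "adj E x y" "(adj (E - {{x, y}}))\<^sup>*\<^sup>* x y"
  shows "\<exists>D\<subseteq>E. is_cycle D \<and> {x, y} \<in> D"
proof -
  let ?r = "adj (E - {{x, y}})"
  obtain xs where xs: "xs \<noteq> []" "hd xs = x" "last xs = y" "distinct xs" "successively ?r xs"
    using rtranclp_distinct_path[OF assms(2)] by blast
  have "x \<noteq> y" using assms(1) by (simp add: adj_def)
  have "3 \<le> length xs"
  proof (rule ccontr)
    assume "\<not> ?thesis"
    then consider a where "xs = [a]" | a b where "xs = [a, b]"
      using xs(1) by (cases xs rule: remdups_adj.cases) (auto simp: not_less_eq_eq)
    then show False using xs \<open>x \<noteq> y\<close> by cases (auto simp: adj_def)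
  qed
  moreover have "successively (adj E) xs"
    by (rule successively_mono[OF xs(5)]) (auto simp: adj_def)
  moreover have "adj E (last xs) (hd xs)" using assms(1) xs adj_sym by metis
  ultimately show ?thesis
    using closed_path_is_cycle[of xs E] xs by (metis insert_commute)
qed

section \<open>Enumerating a cycle in cyclic order\<close>

definition neighbours :: "'a set set \<Rightarrow> 'a \<Rightarrow> 'a set" where
  "neighbours E v = {u. adj E v u}"

lemma card_neighbours_cycle:
  assumes "is_cycle C" "v \<in> \<Union>C"
  shows "card (neighbours C v) = 2"
proof -
  have g: "graph (\<Union>C) C" using assms by (simp add: is_cycle_def)
  have "e \<in> (\<lambda>u. {v, u}) ` neighbours C v" if e: "e \<in> C" "v \<in> e" for e
  proof -
    obtain a b where ab: "e = {a, b}" "adj C a b" using graph_edgeE[OF g e(1)] by metis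
    then have "adj C b a" by (simp add: adj_sym)
    with ab e(2) show ?thesis by (auto simp: neighbours_def insert_commute)
  qed
  then have "{e \<in> C. v \<in> e} = (\<lambda>u. {v, u}) ` neighbours C v"
    by (auto simp: neighbours_def adj_def)
  moreover have "inj_on (\<lambda>u. {v, u}) (neighbours C v)"
    by (auto simp: inj_on_def doubleton_eq_iff)
  moreover have "card {e \<in> C. v \<in> e} = 2" using assms unfolding is_cycle_def by blast
  ultimately show ?thesis by (simp add: card_image)
qed

lemma two_neighbours_cycle:
  assumes "is_cycle C" "v \<in> \<Union>C" "adj C v a" "adj C v b" "a \<noteq> b"
  shows "neighbours C v = {a, b}"
proof -
  have "card (neighbours C v) = card {a, b}"
    using card_neighbours_cycle[OF assms(1,2)] assms(5) by simp
  moreover have "{a, b} \<subseteq> neighbours C v" using assms by (auto simp: neighbours_def)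
  ultimately show ?thesis
    using card_neighbours_cycle assms by (metis card_subset_eq card.infinite zero_neq_numeral)
qed


lemma connected_graph_closed_set:
  assumes "connected_graph V E" "S \<subseteq> V" "S \<noteq> {}" "\<And>v. v \<in> S \<Longrightarrow> neighbours E v \<subseteq> S" "graph V E"
  shows "S = V"
proof (rule ccontr)
  assume "S \<noteq> V"
  then obtain x y where "x \<in> S" "y \<in> V - S" "adj E x y"
    using connected_graph_leaving_edge[OF assms(1) _ assms(3,5)] assms(2) by blast
  then show False using assms(4)[of x] by (auto simp: neighbours_def)
qed

text \<open>Take a longest path in \<open>C\<close> from \<open>v\<close>. Its last vertex has all
  its neighbours on the path, and since all degrees are two, one of them must be \<open>v\<close>.
  The resulting closed path uses up the degree of each of its vertices, so by connectedness it is
  all of \<open>C\<close>. The free choice of \<open>v\<close> expresses that every vertex of a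
  cycle can play the role of 0.\<close>

lemma cycle_enumeration:
  assumes C: "is_cycle C" and v: "v \<in> \<Union>C"
  obtains f where "inj_on f {0..<card (\<Union>C)}" "f 0 = v" "f ` {0..<card (\<Union>C)} = \<Union>C"
    "(`) f ` cycle_edges (card (\<Union>C)) = C"
proof -
  have g: "graph (\<Union>C) C" and fin: "finite (\<Union>C)" and con: "connected_graph (\<Union>C) C"
    using C by (simp_all add: is_cycle_def)
  define P where "P xs \<longleftrightarrow> xs \<noteq> [] \<and> hd xs = v \<and> distinct xs \<and> set xs \<subseteq> \<Union>C \<and> successively (adj C) xs"
    for xs
  have "P [v]" using v by (simp add: P_def)
  moreover have "length xs \<le> card (\<Union>C)" if "P xs" for xs
    using that card_mono[OF fin, of "set xs"] by (simp add: P_def distinct_card)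
  ultimately obtain xs where xs: "P xs" and max: "\<And>ys. P ys \<Longrightarrow> length ys \<le> length xs"
    using ex_has_greatest_nat[of P "[v]" length "Suc (card (\<Union>C))"] by (metis le_imp_less_Suc)
  let ?l = "length xs"
  define z where "z = last xs"
  have p: "xs \<noteq> []" "hd xs = v" "distinct xs" "set xs \<subseteq> \<Union>C" "successively (adj C) xs"
    using xs by (auto simp: P_def)
  have zC: "z \<in> \<Union>C" using p(1,4) last_in_set[OF p(1)] unfolding z_def by blast
  have nz: "neighbours C z \<subseteq> set xs"
  proof
    fix y assume "y \<in> neighbours C z"
    then have y: "adj C z y" by (simp add: neighbours_def)
    show "y \<in> set xs"
    proof (rule ccontr)
      assume "y \<notin> set xs"
      then have "P (xs @ [y])"
        using p y graph_adj_in[OF g y] by (auto simp: P_def z_def successively_append_iff)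
      then show False using max by fastforce
    qed
  qed
  have cz: "card (neighbours C z) = 2" by (rule card_neighbours_cycle[OF C zC])
  have "z \<notin> neighbours C z" by (simp add: neighbours_def adj_def)
  \<comment> \<open>The end \<open>z\<close> and its two neighbours all lie on the path, which gives
    the length needed to close it.\<close>
  then have "card (insert z (neighbours C z)) = 3"
    using cz by (subst card_insert_disjoint) (auto intro: card_ge_0_finite)
  moreover have "insert z (neighbours C z) \<subseteq> set xs" using nz p(1) by (simp add: z_def)
  ultimately have l3: "3 \<le> ?l"
    by (metis List.finite_set card_length card_mono le_trans)
  have consec: "adj C (xs ! i) (xs ! Suc i)" if "Suc i < ?l" for i
    using p(5) that by (simp add: successively_conv_nth)
  have eqi: "xs ! i = xs ! j \<longleftrightarrow> i = j" if "i < ?l" "j < ?l" for i j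
    using p(3) that by (simp add: nth_eq_iff_index_eq)
  have inC: "xs ! i \<in> \<Union>C" if "i < ?l" for i using p(4) that nth_mem by blast
  have zn: "z = xs ! (?l - 1)" using p(1) by (simp add: z_def last_conv_nth)
  have closing: "adj C z v"
  proof -
    \<comment> \<open>Besides its predecessor on the path, \<open>z\<close> has a second neighbour
      \<open>y\<close>; it remains to see that \<open>y\<close> is the first vertex.\<close>
    have "\<not> neighbours C z \<subseteq> {xs ! (?l - 2)}"
      using cz card_mono[of "{xs ! (?l - 2)}" "neighbours C z"] by auto
    then obtain y where y: "adj C z y" "y \<noteq> xs ! (?l - 2)" by (auto simp: neighbours_def)
    then obtain i where i: "i < ?l" "y = xs ! i"
      using nz unfolding neighbours_def by (metis in_set_conv_nth mem_Collect_eq subsetD)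
    have "z \<noteq> y" using y by (simp add: adj_def)
    then have i2: "i \<noteq> ?l - 1" "i \<noteq> ?l - 2" using i y zn by auto
    \<comment> \<open>An inner vertex of the path already has two neighbours on it, and
      \<open>z\<close> would be a third because \<open>i\<close> is not
      \<open>?l - 2\<close>.\<close>
    have "i = 0"
    proof (rule ccontr)
      assume "i \<noteq> 0"
      then obtain j where j: "i = Suc j" by (cases i) auto
      have "neighbours C y = {xs ! j, xs ! Suc i}"
      proof (rule two_neighbours_cycle[OF C])
        show "y \<in> \<Union>C" using inC i by simp
        show "adj C y (xs ! j)" using consec[of j] i j adj_sym by auto
        show "adj C y (xs ! Suc i)" using consec[of i] i i2 by auto
        show "xs ! j \<noteq> xs ! Suc i" using eqi[of j "Suc i"] i i2 j by auto
      qed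
      moreover have "z \<in> neighbours C y" using y adj_sym by (auto simp: neighbours_def)
      ultimately have "?l - 1 = j \<or> ?l - 1 = Suc i"
        using eqi[of "?l - 1" j] eqi[of "?l - 1" "Suc i"] i i2 j zn by auto
      then show False using i i2 j by auto
    qed
    then show ?thesis using y i p(1,2) by (simp add: hd_conv_nth)
  qed
  note D = closed_path_is_cycle[OF p(3) l3 p(5)]
  have lh: "adj C (last xs) (hd xs)" using closing p(2) by (simp add: z_def)
  let ?D = "(`) ((!) xs) ` cycle_edges ?l"
  have DC: "is_cycle ?D" "?D \<subseteq> C" using D[OF lh] by auto
  have UD: "\<Union>?D = set xs"
    using Union_cycle_edges[OF l3] by (metis image_Union list.set_map map_nth set_upt)
  \<comment> \<open>Both neighbourhoods have two elements and one contains the other. Hence no edge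
    of \<open>C\<close> leaves the path.\<close>
  have nbeq: "neighbours C u = neighbours ?D u" if "u \<in> set xs" for u
  proof -
    have "neighbours ?D u \<subseteq> neighbours C u" using DC(2) by (auto simp: neighbours_def adj_def)
    moreover have "card (neighbours ?D u) = 2" "card (neighbours C u) = 2"
      using card_neighbours_cycle DC(1) C UD that p(4) by (metis, metis subsetD)
    ultimately show ?thesis by (metis card_subset_eq card.infinite zero_neq_numeral)
  qed
  have gD: "graph (set xs) ?D" using DC(1) UD by (metis is_cycle_def)
  have all: "set xs = \<Union>C"
  proof (rule connected_graph_closed_set[OF con p(4) _ _ g])
    show "neighbours C u \<subseteq> set xs" if "u \<in> set xs" for u
      using nbeq[OF that] graph_adj_in[OF gD] by (auto simp: neighbours_def)
  qed (use p(1) in simp)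
  have "C \<subseteq> ?D"
  proof
    fix e assume e: "e \<in> C"
    then obtain a b where ab: "e = {a, b}" "adj C a b" "a \<in> \<Union>C" using graph_edgeE[OF g] by metis
    then have "b \<in> neighbours ?D a" using nbeq[of a] all by (auto simp: neighbours_def)
    then show "e \<in> ?D" using ab by (simp add: neighbours_def adj_def)
  qed
  with DC have "?D = C" by blast
  moreover have len: "?l = card (\<Union>C)" using p(3) all distinct_card by metis
  moreover have "inj_on ((!) xs) {0..<?l}" using p(3) by (auto simp: inj_on_def eqi)
  moreover have "(!) xs ` {0..<?l} = \<Union>C" using all by (metis list.set_map map_nth set_upt)
  moreover have "xs ! 0 = v" using p(1,2) by (simp add: hd_conv_nth)
  ultimately show ?thesis using that[of "(!) xs"] by simp
qed

text \<open>Reconciles two measures of length: \<open>has_girth\<close> counts edges, while the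
  enumeration and \<open>grown_unicyclic\<close> count vertices.\<close>

lemma card_Union_cycle:
  assumes "is_cycle C"
  shows "card (\<Union>C) = card C"
proof -
  have l: "3 \<le> card (\<Union>C)" using assms by (simp add: is_cycle_def)
  then obtain v where "v \<in> \<Union>C" by (metis all_not_in_conv card.empty not_numeral_le_zero)
  then obtain f where f: "inj_on f {0..<card (\<Union>C)}" "(`) f ` cycle_edges (card (\<Union>C)) = C"
    using cycle_enumeration[OF assms] by metis
  have "inj_on ((`) f) (cycle_edges (card (\<Union>C)))"
    by (rule inj_on_subset[OF inj_on_image_Pow[OF f(1)]])
      (use Union_cycle_edges[OF l] in blast)
  then show ?thesis using f(2) card_image card_cycle_edges[OF l] by metis
qed

section \<open>Leaves\<close>

text \<open>Take a non-cut vertex \<open>w\<close> outside \<open>S\<close>. If it had two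
  neighbours, a path joining them in the connected graph without \<open>w\<close> would yield a
  cycle through \<open>w\<close>, but all cycles lie in \<open>S\<close>. Trees use this with
  \<open>S\<close> a single vertex, unicyclic graphs with \<open>S\<close> the vertex set of the
  cycle.\<close>

lemma leaf_exists:
  assumes g: "graph V E" and con: "connected_graph V E"
    and S: "S \<subset> V" "connected_graph S {e \<in> E. e \<subseteq> S}"
    and cyc: "\<And>D. D \<in> cycles V E \<Longrightarrow> \<Union>D \<subseteq> S"
  obtains u w E' where "w \<in> V - S" "u \<in> V - {w}" "E = insert {u, w} E'"
    "graph (V - {w}) E'" "connected_graph (V - {w}) E'"
proof -
  obtain w where w: "w \<in> V - S" and cw: "connected_graph (V - {w}) {e \<in> E. e \<subseteq> V - {w}}"
    using non_cut_vertex_exists[OF g con S] by blast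
  let ?E = "{e \<in> E. e \<subseteq> V - {w}}"
  have "V - {w} \<noteq> {}" using cw by (simp add: connected_graph_def)
  then obtain u where u: "u \<in> V - {w}" "adj E u w"
    using connected_graph_leaving_edge[OF con _ _ g, of "V - {w}"] w by blast
  have "a = u" if a: "adj E a w" for a
  proof (rule ccontr)
    assume "a \<noteq> u"
    have "a \<in> V - {w}" using graph_adj_in[OF g a] a by (auto simp: adj_def)
    then have "(adj ?E)\<^sup>*\<^sup>* a u" using cw u by (simp add: connected_graph_def)
    then have "(adj (E - {{w, u}}))\<^sup>*\<^sup>* a u" by (rule adj_rtranclp_mono) auto
    moreover have "adj (E - {{w, u}}) w a"
      using a \<open>a \<noteq> u\<close> by (auto simp: adj_def insert_commute doubleton_eq_iff)
    ultimately have "(adj (E - {{w, u}}))\<^sup>*\<^sup>* w u" by (rule converse_rtranclp_into_rtranclp[rotated])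
    from edge_in_cycle[OF adj_sym[OF u(2)] this] obtain D where "D \<subseteq> E" "is_cycle D" "{w, u} \<in> D"
      by blast
    then show False using cyc[of D] w by (auto simp: cycles_def)
  qed
  then have only: "e = {u, w}" if e: "e \<in> E" "w \<in> e" for e
  proof -
    obtain a b where "e = {a, b}" "adj E a b" using graph_edgeE[OF g e(1)] by metis
    with e(2) \<open>\<And>a. adj E a w \<Longrightarrow> a = u\<close> adj_sym show ?thesis by fastforce
  qed
  have "E = insert {u, w} ?E"
  proof
    show "E \<subseteq> insert {u, w} ?E" using only graph_edge_subset[OF g] by blast
    show "insert {u, w} ?E \<subseteq> E" using u by (auto simp: adj_def)
  qed
  moreover have "graph (V - {w}) ?E" by (rule graph_subset[OF g]) auto
  ultimately show ?thesis using that[of w u ?E] w u cw by blast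
qed

lemma graph_insert_leaf:
  assumes "graph V E" "u \<in> V" "w \<notin> V"
  shows "graph (insert w V) (insert {u, w} E)"
  using assms unfolding graph_def by (metis finite.insertI insert_iff)

text \<open>A cycle through the new edge would need two edges at \<open>w\<close>, and there is only
  one.\<close>

lemma cycle_avoids_leaf:
  assumes g: "graph V E" and u: "u \<in> V" and w: "w \<notin> V"
    and D: "is_cycle D" "D \<subseteq> insert {u, w} E"
  shows "D \<subseteq> E"
proof (rule ccontr)
  assume "\<not> D \<subseteq> E"
  then have "{u, w} \<in> D" using D by blast
  then have "card {e \<in> D. w \<in> e} = 2" using D(1) by (auto simp: is_cycle_def)
  moreover have "{e \<in> D. w \<in> e} \<subseteq> {{u, w}}" using D(2) w graph_edge_subset[OF g] by blast
  ultimately show False using card_mono[of "{{u, w}}" "{e \<in> D. w \<in> e}"] by simp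
qed

text \<open>Trees described by leaf attachment, so that statements about subtrees can be proved by
  induction rather than from the absence of cycles.\<close>

inductive grown_tree :: "'a set \<Rightarrow> 'a set set \<Rightarrow> bool" where
  single: "grown_tree {v} {}"
| leaf: "grown_tree V E \<Longrightarrow> u \<in> V \<Longrightarrow> w \<notin> V \<Longrightarrow> grown_tree (insert w V) (insert {u, w} E)"

lemma is_tree_if_grown_tree:
  assumes "grown_tree V E"
  shows "is_tree V E"
  using assms
proof induction
  case (single v)
  have "\<not> is_cycle {}" by (simp add: is_cycle_def)
  then show ?case by (auto simp: is_tree_def graph_def connected_graph_def cycles_def)
next
  case (leaf V E u w)
  then have t: "graph V E" "connected_graph V E" "cycles V E = {}" by (auto simp: is_tree_def)
  have "cycles (insert w V) (insert {u, w} E) = {}"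
    using t(3) cycle_avoids_leaf[OF t(1) leaf(2,3)] by (auto simp: cycles_def)
  then show ?case
    using t leaf by (simp add: is_tree_def graph_insert_leaf connected_graph_insert)
qed

lemma grown_tree_if_is_tree:
  assumes "is_tree V E"
  shows "grown_tree V E"
  using assms
proof (induction "card V" arbitrary: V E rule: less_induct)
  case less
  have t: "graph V E" "connected_graph V E" "cycles V E = {}"
    using less(2) by (auto simp: is_tree_def)
  then obtain v where v: "v \<in> V" by (auto simp: connected_graph_def)
  show ?case
  proof (cases "V = {v}")
    case True
    then have "E = {}" using t(1) by (auto simp: graph_def)
    then show ?thesis using True by (simp add: grown_tree.single)
  next
    case False
    then have "{v} \<subset> V" using v by blast
    moreover have "connected_graph {v} {e \<in> E. e \<subseteq> {v}}" by (simp add: connected_graph_def)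
    ultimately obtain u w E' where w: "w \<in> V - {v}" "u \<in> V - {w}" "E = insert {u, w} E'"
      "graph (V - {w}) E'" "connected_graph (V - {w}) E'"
      using t(3) by (elim leaf_exists[OF t(1,2)]) simp_all
    have "is_tree (V - {w}) E'" using w t(3) by (auto simp: is_tree_def cycles_def)
    moreover have "card (V - {w}) < card V"
      using w t(1) by (intro psubset_card_mono) (auto simp: graph_def)
    ultimately have "grown_tree (V - {w}) E'" using less(1) by blast
    from grown_tree.leaf[OF this w(2), of w] w(1,3) show ?thesis by (simp add: insert_absorb)
  qed
qed

lemma is_tree_iff_grown_tree: "is_tree V E \<longleftrightarrow> grown_tree V E"
  using grown_tree_if_is_tree is_tree_if_grown_tree by blast

inductive grown_unicyclic :: "nat \<Rightarrow> 'a set \<Rightarrow> 'a set set \<Rightarrow> bool" for l where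
  cycle: "is_cycle C \<Longrightarrow> card (\<Union>C) = l \<Longrightarrow> grown_unicyclic l (\<Union>C) C"
| leaf: "grown_unicyclic l V E \<Longrightarrow> u \<in> V \<Longrightarrow> w \<notin> V \<Longrightarrow>
    grown_unicyclic l (insert w V) (insert {u, w} E)"

text \<open>If \<open>C\<close> spans the graph, an edge outside \<open>C\<close> would close a path
  in \<open>C\<close> to a second cycle, so \<open>E\<close> is \<open>C\<close>. Otherwise there is
  a leaf outside \<open>C\<close>; removing it leaves \<open>C\<close> as the only cycle, and
  induction on the number of vertices applies.\<close>

lemma grown_unicyclic_if_one_cycle:
  assumes "graph V E" "connected_graph V E" "cycles V E = {C}"
  shows "grown_unicyclic (card C) V E"
  using assms
proof (induction "card V" arbitrary: V E rule: less_induct)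
  case less
  note g = less(2) and con = less(3) and cyc = less(4)
  have C: "is_cycle C" "C \<subseteq> E" using cyc by (auto simp: cycles_def)
  have gC: "graph (\<Union>C) C" and cC: "connected_graph (\<Union>C) C" using C by (auto simp: is_cycle_def)
  have UC: "\<Union>C \<subseteq> V" using C(2) graph_edge_subset[OF g] by blast
  show ?case
  proof (cases "\<Union>C = V")
    case True
    have "E \<subseteq> C"
    proof
      fix e assume e: "e \<in> E"
      show "e \<in> C"
      proof (rule ccontr)
        assume "e \<notin> C"
        obtain x y where xy: "x \<in> V" "y \<in> V" "e = {x, y}" "adj E x y"
          using graph_edgeE[OF g e] by metis
        have "(adj C)\<^sup>*\<^sup>* x y" using cC True xy by (auto simp: connected_graph_def)
        then have "(adj (E - {{x, y}}))\<^sup>*\<^sup>* x y"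
          by (rule adj_rtranclp_mono) (use C(2) \<open>e \<notin> C\<close> xy(3) in blast)
        from edge_in_cycle[OF xy(4) this] obtain D where "D \<subseteq> E" "is_cycle D" "{x, y} \<in> D"
          by blast
        then show False using cyc \<open>e \<notin> C\<close> xy(3) by (auto simp: cycles_def)
      qed
    qed
    then have "E = C" using C(2) by blast
    then show ?thesis
      using grown_unicyclic.cycle[OF C(1) card_Union_cycle[OF C(1)]] True by simp
  next
    case False
    have "connected_graph (\<Union>C) {e \<in> E. e \<subseteq> \<Union>C}"
      by (rule connected_graph_mono[OF cC]) (use C(2) in blast)
    then obtain u w E' where w: "w \<in> V - \<Union>C" "u \<in> V - {w}" "E = insert {u, w} E'"
      "graph (V - {w}) E'" "connected_graph (V - {w}) E'"
      using UC False cyc by (elim leaf_exists[OF g con, rotated]) auto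
    have "C \<subseteq> E'" using w(1,3) C(2) by blast
    then have "C \<in> cycles (V - {w}) E'" using C(1) by (simp add: cycles_def)
    moreover have "cycles (V - {w}) E' \<subseteq> cycles V E" unfolding cycles_def using w(3) by blast
    ultimately have "cycles (V - {w}) E' = {C}" unfolding cyc by blast
    moreover have "card (V - {w}) < card V"
      using w g by (intro psubset_card_mono) (auto simp: graph_def)
    ultimately have "grown_unicyclic (card C) (V - {w}) E'" using less(1) w by blast
    from grown_unicyclic.leaf[OF this w(2), of w] w(1,3) show ?thesis
      by (simp add: insert_absorb)
  qed
qed

section \<open>Counting subtrees\<close>

lemma grown_tree_graph: "grown_tree V E \<Longrightarrow> graph V E"
  using is_tree_if_grown_tree by (auto simp: is_tree_def)

lemma grown_tree_nonempty: "grown_tree V E \<Longrightarrow> V \<noteq> {}"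
  by (induction rule: grown_tree.induct) auto

lemma grown_tree_single: "grown_tree {v} E \<Longrightarrow> E = {}"
  by (drule grown_tree_graph) (auto simp: graph_def)

lemma grown_tree_image:
  assumes "grown_tree V E" "inj_on f V"
  shows "grown_tree (f ` V) ((`) f ` E)"
  using assms
proof induction
  case (single v)
  then show ?case by (simp add: grown_tree.single)
next
  case (leaf V E u w)
  then have "grown_tree (f ` V) ((`) f ` E)" "f u \<in> f ` V" "f w \<notin> f ` V" by auto
  from grown_tree.leaf[OF this] show ?case by simp
qed

text \<open>The leaf \<open>w\<close> need not be the vertex attached last, nor need it differ from
  the starting vertex. If it came last, undo that step; otherwise remove it from the earlier tree
  and repeat the last attachment.\<close>

lemma grown_tree_remove_leaf:
  assumes "grown_tree V E" "w \<in> V" "V \<noteq> {w}" "u \<noteq> w" "\<And>e. e \<in> E \<Longrightarrow> w \<in> e \<Longrightarrow> e = {u, w}"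
  shows "u \<in> V \<and> {u, w} \<in> E \<and> grown_tree (V - {w}) (E - {{u, w}})"
  using assms
proof (induction rule: grown_tree.induct)
  case (single v)
  then show ?case by simp
next
  case (leaf V E a b)
  have g: "graph V E" using leaf(1) by (rule grown_tree_graph)
  show ?case
  proof (cases "w = b")
    case True
    then have "a = u" using leaf.prems(4)[of "{a, b}"] leaf.prems(3) by (auto simp: doubleton_eq_iff)
    moreover have "{u, w} \<notin> E" using graph_edge_subset[OF g] True leaf(3) by blast
    ultimately show ?thesis using True leaf by simp
  next
    case False
    then have w: "w \<in> V" using leaf by simp
    show ?thesis
    proof (cases "V = {w}")
      \<comment> \<open>Here growth started at \<open>w\<close> and the vertex attached next is its
        only neighbour, so after the removal the tree restarts from \<open>b\<close>, which equals
        \<open>u\<close>.\<close>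
      case True
      then have "a = w" using leaf.hyps(2) by simp
      moreover have "E = {}" using leaf.hyps(1) unfolding True by (rule grown_tree_single)
      moreover from \<open>a = w\<close> have "u = b"
        using leaf.prems(4)[of "{a, b}"] leaf.prems(3) by (auto simp: doubleton_eq_iff)
      moreover have "insert b V - {w} = {b}" using True False by auto
      ultimately show ?thesis using True by (simp add: insert_commute grown_tree.single)
    next
      case nw: False
      have IH: "u \<in> V" "{u, w} \<in> E" "grown_tree (V - {w}) (E - {{u, w}})"
        using leaf.IH[OF w nw leaf.prems(3)] leaf.prems(4) by auto
      \<comment> \<open>A vertex \<open>b\<close> hung on \<open>w\<close> would be a second
        neighbour of \<open>w\<close> next to \<open>u\<close>.\<close>
      have "a \<noteq> w"
      proof
        assume "a = w"
        then have "{w, b} = {u, w}" using leaf.prems(4)[of "{a, b}"] by simp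
        then show False using IH(1) leaf.hyps(3) False by (auto simp: doubleton_eq_iff)
      qed
      then have "grown_tree (insert b (V - {w})) (insert {a, b} (E - {{u, w}}))"
        using IH leaf by (intro grown_tree.leaf) auto
      moreover have "insert b (V - {w}) = insert b V - {w}" using False by auto
      moreover have "{a, b} \<noteq> {u, w}" using \<open>a \<noteq> w\<close> False by (auto simp: doubleton_eq_iff)
      then have "insert {a, b} (E - {{u, w}}) = insert {a, b} E - {{u, w}}" by auto
      ultimately show ?thesis using IH by simp
    qed
  qed
qed

text \<open>The set \<open>A\<close> of prescribed vertices treats all subtrees, those through one
  vertex and those through two in the same way; attaching a leaf turns one kind of count into
  another.\<close>

definition subtrees_over :: "nat \<Rightarrow> 'a set \<Rightarrow> 'a set set \<Rightarrow> 'a set \<Rightarrow> ('a set \<times> 'a set set) set" where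
  "subtrees_over k V E A =
    {(V', E'). V' \<subseteq> V \<and> E' \<subseteq> E \<and> grown_tree V' E' \<and> card V' = k \<and> A \<subseteq> V'}"

definition nsub_over :: "nat \<Rightarrow> 'a set \<Rightarrow> 'a set set \<Rightarrow> 'a set \<Rightarrow> nat" where
  "nsub_over k V E A = card (subtrees_over k V E A)"

lemma nsub_eq_nsub_over: "nsub k V E = (if k = 0 then 1 else nsub_over k V E {})"
proof -
  have "{T \<in> subtrees V E. card (fst T) = k} = subtrees_over k V E {}"
    by (auto simp: subtrees_def subtrees_over_def is_tree_iff_grown_tree)
  then show ?thesis by (simp add: nsub_def nsub_over_def)
qed

lemma finite_subtrees_over: "graph V E \<Longrightarrow> finite (subtrees_over k V E A)"
  by (rule finite_subset[of _ "Pow V \<times> Pow E"])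
    (use graph_finite[of V E] in \<open>simp, auto simp: subtrees_over_def\<close>)

text \<open>Trees are nonempty. This is the honest count at 0, in contrast to the convention that
  \<open>nsub\<close> has value 1 there.\<close>

lemma nsub_over_0:
  assumes "graph V E"
  shows "nsub_over 0 V E A = 0"
proof -
  have "subtrees_over 0 V E A = {}"
    using grown_tree_nonempty grown_tree_graph graph_finite
    by (fastforce simp: subtrees_over_def card_eq_0_iff)
  then show ?thesis by (simp add: nsub_over_def)
qed

lemma nsub_over_antimono:
  "graph V E \<Longrightarrow> A \<subseteq> B \<Longrightarrow> nsub_over k V E B \<le> nsub_over k V E A"
  unfolding nsub_over_def
  by (rule card_mono[OF finite_subtrees_over]) (auto simp: subtrees_over_def)

lemma nsub_over_1:
  assumes "v \<in> V"
  shows "nsub_over (Suc 0) V E {v} = 1"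
proof -
  have "x \<in> subtrees_over (Suc 0) V E {v} \<longleftrightarrow> x = ({v}, {})" for x
  proof
    assume "x \<in> subtrees_over (Suc 0) V E {v}"
    then obtain W F where x: "x = (W, F)" "grown_tree W F" "card W = Suc 0" "v \<in> W"
      by (auto simp: subtrees_over_def)
    then have "W = {v}" by (metis card_1_singletonE One_nat_def singletonD)
    moreover from this have "F = {}" using grown_tree_single x(2) by metis
    ultimately show "x = ({v}, {})" using x(1) by simp
  next
    show "x = ({v}, {}) \<Longrightarrow> x \<in> subtrees_over (Suc 0) V E {v}"
      using assms by (simp add: subtrees_over_def grown_tree.single)
  qed
  then have "subtrees_over (Suc 0) V E {v} = {({v}, {})}" by blast
  then show ?thesis by (simp add: nsub_over_def)
qed

text \<open>A subtree with \<open>card V\<close> vertices spans \<open>V\<close>, so it contains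
  every prescribed vertex anyway.\<close>

lemma nsub_over_card:
  assumes "graph V E" "A \<subseteq> V"
  shows "nsub_over (card V) V E A = nsub_over (card V) V E {}"
proof -
  have "V' = V" if "V' \<subseteq> V" "card V' = card V" for V'
    using card_subset_eq[OF _ that] assms(1) by (simp add: graph_def)
  then have "subtrees_over (card V) V E A = subtrees_over (card V) V E {}"
    using assms(2) by (auto simp: subtrees_over_def)
  then show ?thesis by (simp add: nsub_over_def)
qed

lemma nsub_over_gt_card:
  assumes "graph V E" "card V < k"
  shows "nsub_over k V E A = 0"
proof -
  have "card V' < k" if "V' \<subseteq> V" for V'
    using card_mono[OF _ that] assms by (auto simp: graph_def)
  then have "subtrees_over k V E A = {}" by (auto simp: subtrees_over_def)
  then show ?thesis by (simp add: nsub_over_def)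
qed

lemma nsub_over_image_le:
  assumes "graph V E" "inj_on f V"
  shows "nsub_over k V E A \<le> nsub_over k (f ` V) ((`) f ` E) (f ` A)"
  unfolding nsub_over_def
proof (rule card_inj_on_le[where f = "\<lambda>(W, F). (f ` W, (`) f ` F)"])
  have "E \<subseteq> Pow V" using graph_edge_subset[OF assms(1)] by blast
  then have "inj_on ((`) f) E" using inj_on_image_Pow[OF assms(2)] inj_on_subset by blast
  moreover have "subtrees_over k V E A \<subseteq> Pow V \<times> Pow E" by (auto simp: subtrees_over_def)
  ultimately show "inj_on (\<lambda>(W, F). (f ` W, (`) f ` F)) (subtrees_over k V E A)"
    using inj_on_subset[OF map_prod_inj_on[OF inj_on_image_Pow inj_on_image_Pow]] assms(2)
    by (simp add: map_prod_def)
  show "(\<lambda>(W, F). (f ` W, (`) f ` F)) ` subtrees_over k V E A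
    \<subseteq> subtrees_over k (f ` V) ((`) f ` E) (f ` A)"
  proof clarify
    fix W F assume "(W, F) \<in> subtrees_over k V E A"
    then have W: "W \<subseteq> V" "F \<subseteq> E" "grown_tree W F" "card W = k" "A \<subseteq> W"
      by (auto simp: subtrees_over_def)
    have "inj_on f W" using assms(2) W(1) by (rule inj_on_subset)
    then show "(f ` W, (`) f ` F) \<in> subtrees_over k (f ` V) ((`) f ` E) (f ` A)"
      using W by (auto simp: subtrees_over_def card_image grown_tree_image)
  qed
  show "finite (subtrees_over k (f ` V) ((`) f ` E) (f ` A))"
    by (rule finite_subtrees_over[OF graph_image[OF assms]])
qed

text \<open>The inequality for \<open>f\<close> and the one for its inverse combine to an
  equality.\<close>

lemma nsub_over_image:
  assumes "graph V E" "inj_on f V" "A \<subseteq> V"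
  shows "nsub_over k (f ` V) ((`) f ` E) (f ` A) = nsub_over k V E A"
proof (rule antisym[OF _ nsub_over_image_le[OF assms(1,2)]])
  let ?g = "inv_into V f"
  have inv: "?g ` f ` B = B" if "B \<subseteq> V" for B using that assms(2) by (rule inv_into_image_cancel[rotated])
  have "(`) ?g ` (`) f ` E = (\<lambda>e. ?g ` f ` e) ` E" by (rule image_image)
  also have "\<dots> = E" using inv graph_edge_subset[OF assms(1)] by (simp cong: image_cong)
  finally have "(`) ?g ` (`) f ` E = E" .
  then show "nsub_over k (f ` V) ((`) f ` E) (f ` A) \<le> nsub_over k V E A"
    using nsub_over_image_le[OF graph_image[OF assms(1,2)], of ?g k "f ` A"]
      inv[OF assms(3)] inv[OF order_refl] inj_on_inv_into[of "f ` V" f V] by simp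
qed

section \<open>Effect of an attached leaf on the counts\<close>

context
  fixes V :: "'a set" and E u w
  assumes g: "graph V E" and u: "u \<in> V" and w: "w \<notin> V"
begin

text \<open>Subtrees are split by whether they contain \<open>w\<close>; one that avoids
  \<open>w\<close> cannot use the edge \<open>{u, w}\<close> and so lies in the old graph.\<close>

lemma nsub_over_split_leaf:
  assumes "A \<subseteq> V"
  shows "nsub_over k (insert w V) (insert {u, w} E) A =
    nsub_over k V E A + nsub_over k (insert w V) (insert {u, w} E) (insert w A)"
proof -
  let ?S = "subtrees_over k (insert w V) (insert {u, w} E)"
  have "(W, F) \<in> subtrees_over k V E A" if "(W, F) \<in> ?S A" "w \<notin> W" for W F
  proof -
    have F: "grown_tree W F" "F \<subseteq> insert {u, w} E" using that by (auto simp: subtrees_over_def)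
    then have "{u, w} \<notin> F" using that(2) graph_edge_subset[OF grown_tree_graph] by blast
    with F that show ?thesis by (auto simp: subtrees_over_def)
  qed
  then have "?S A = subtrees_over k V E A \<union> ?S (insert w A)"
    by (auto simp: subtrees_over_def)
  moreover have "subtrees_over k V E A \<inter> ?S (insert w A) = {}"
    using w by (auto simp: subtrees_over_def)
  ultimately show ?thesis unfolding nsub_over_def
    using finite_subtrees_over[OF g] finite_subtrees_over[OF graph_insert_leaf[OF g u w]]
    by (metis card_Un_disjoint)
qed

text \<open>Deleting \<open>w\<close> with its edge is a bijection. A subtree through
  \<open>w\<close> with more than one vertex must contain \<open>u\<close>; the condition on
  \<open>k\<close> excludes the one-vertex tree at \<open>w\<close>.\<close>

lemma nsub_over_at_leaf:
  assumes "A \<subseteq> V" "k \<noteq> 0"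
  shows "nsub_over (Suc k) (insert w V) (insert {u, w} E) (insert w A) = nsub_over k V E (insert u A)"
proof -
  let ?S = "subtrees_over (Suc k) (insert w V) (insert {u, w} E) (insert w A)"
  let ?R = "subtrees_over k V E (insert u A)"
  have fin: "finite V" using g by (simp add: graph_def)
  have uw: "u \<noteq> w" using u w by auto
  have eV: "e \<subseteq> V" if "e \<in> E" for e using graph_edge_subset[OF g that] .
  define attach where "attach = (\<lambda>(W, F). (insert w W, insert {u, w} F))"
  define detach where "detach = (\<lambda>(W, F). (W - {w}, F - {{u, w}}))"
  have S: "w \<in> W" "{u, w} \<in> F" "(W - {w}, F - {{u, w}}) \<in> ?R" if "(W, F) \<in> ?S" for W F
  proof -
    have W: "W \<subseteq> insert w V" "F \<subseteq> insert {u, w} E" "grown_tree W F" "card W = Suc k" "w \<in> W" "A \<subseteq> W"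
      using that by (simp_all add: subtrees_over_def)
    have "W \<noteq> {w}" using assms(2) W(4) by auto
    moreover have "e = {u, w}" if "e \<in> F" "w \<in> e" for e using that W(2) eV w by blast
    ultimately have T: "u \<in> W" "{u, w} \<in> F" "grown_tree (W - {w}) (F - {{u, w}})"
      using grown_tree_remove_leaf[OF W(3,5) _ uw] by simp_all
    show "w \<in> W" "{u, w} \<in> F" by (fact W(5) T(2))+
    have "card (W - {w}) = k" using W(4,5) by simp
    moreover have "W - {w} \<subseteq> V" "F - {{u, w}} \<subseteq> E" "insert u A \<subseteq> W - {w}"
      using W T(1) assms(1) w uw by blast+
    ultimately show "(W - {w}, F - {{u, w}}) \<in> ?R" using T(3) by (simp add: subtrees_over_def)
  qed
  have R: "w \<notin> W" "{u, w} \<notin> F" "(insert w W, insert {u, w} F) \<in> ?S" if "(W, F) \<in> ?R" for W F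
  proof -
    have W: "W \<subseteq> V" "F \<subseteq> E" "grown_tree W F" "card W = k" "u \<in> W" "A \<subseteq> W"
      using that by (simp_all add: subtrees_over_def)
    show wW: "w \<notin> W" and "{u, w} \<notin> F" using W(1,2) w eV by blast+
    have "finite W" using W(1) fin by (rule finite_subset)
    then have "card (insert w W) = Suc k" using wW W(4) by simp
    moreover have "insert w W \<subseteq> insert w V" "insert {u, w} F \<subseteq> insert {u, w} E" "insert w A \<subseteq> insert w W"
      using W by blast+
    ultimately show "(insert w W, insert {u, w} F) \<in> ?S"
      using grown_tree.leaf[OF W(3,5) wW] by (simp add: subtrees_over_def)
  qed
  have "bij_betw attach ?R ?S"
  proof (rule bij_betw_byWitness[where f' = detach])
    show "\<forall>x\<in>?R. detach (attach x) = x" using R(1,2) by (auto simp: attach_def detach_def)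
    show "\<forall>x\<in>?S. attach (detach x) = x" using S(1,2) by (auto simp: attach_def detach_def)
    show "attach ` ?R \<subseteq> ?S" using R(3) by (auto simp: attach_def)
    show "detach ` ?S \<subseteq> ?R" using S(3) by (auto simp: detach_def)
  qed
  then show ?thesis unfolding nsub_over_def by (metis bij_betw_same_card)
qed

lemma nsub_over_leaf:
  "nsub_over (Suc k) (insert w V) (insert {u, w} E) {w} = (if k = 0 then 1 else nsub_over k V E {u})"
  using nsub_over_at_leaf[of "{}" k] by (simp add: nsub_over_1)

lemma nsub_over_insert_leaf:
  assumes "v \<in> V" "k \<noteq> 0"
  shows "nsub_over (Suc k) (insert w V) (insert {u, w} E) {v} =
    nsub_over (Suc k) V E {v} + nsub_over k V E {u, v}"
  using assms nsub_over_split_leaf[of "{v}"] nsub_over_at_leaf[of "{v}" k] by simp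

end


section \<open>Subtrees of a cycle\<close>

text \<open>The index \<open>j\<close> counts edges: for \<open>j < l\<close> the arc is a path with
  \<open>j + 1\<close> vertices, and for larger \<open>j\<close> it wraps around.\<close>

definition arc_vertices :: "nat \<Rightarrow> nat \<Rightarrow> nat \<Rightarrow> nat set" where
  "arc_vertices l a j = (\<lambda>i. (a + i) mod l) ` {..j}"

definition arc_edges :: "nat \<Rightarrow> nat \<Rightarrow> nat \<Rightarrow> nat set set" where
  "arc_edges l a j = (\<lambda>i. {(a + i) mod l, Suc (a + i) mod l}) ` {..<j}"

lemma arc_vertices_Suc: "arc_vertices l a (Suc j) = insert (Suc (a + j) mod l) (arc_vertices l a j)"
  by (simp add: arc_vertices_def atMost_Suc)

lemma arc_edges_Suc:
  "arc_edges l a (Suc j) = insert {(a + j) mod l, Suc (a + j) mod l} (arc_edges l a j)"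
  by (simp add: arc_edges_def lessThan_Suc)

text \<open>Extension at the start of the arc, for leaves that precede it in cyclic order.\<close>

lemma arc_vertices_Suc_start:
  "arc_vertices l a (Suc j) = insert (a mod l) (arc_vertices l (Suc a mod l) j)"
  by (simp add: arc_vertices_def atMost_Suc_eq_insert_0 image_image mod_add_left_eq del: atMost_Suc)

lemma arc_edges_Suc_start:
  "arc_edges l a (Suc j) = insert {a mod l, Suc a mod l} (arc_edges l (Suc a mod l) j)"
proof -
  have "Suc (Suc a mod l + i) mod l = Suc (Suc (a + i)) mod l" for i
    by (metis add_Suc add_Suc_right mod_add_left_eq)
  then show ?thesis
    by (simp add: arc_edges_def lessThan_Suc_eq_insert_0 image_image mod_add_left_eq del: lessThan_Suc)
qed

lemma mod_shift_inj:
  assumes "i < l" "j < l" "(a + i) mod l = (a + j) mod (l::nat)"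
  shows "i = j"
proof -
  have "int l dvd (int a + int i) - (int a + int j)"
    using assms(3) by (metis mod_eq_dvd_iff of_nat_add zmod_int)
  then have "int l dvd int i - int j" by simp
  then have "int i mod int l = int j mod int l" by (simp add: mod_eq_dvd_iff)
  then show ?thesis using assms(1,2) by simp
qed

lemma card_arc_vertices:
  assumes "j < l"
  shows "card (arc_vertices l a j) = Suc j"
proof -
  have "inj_on (\<lambda>i. (a + i) mod l) {..j}"
    using assms mod_shift_inj by (intro inj_onI) (meson atMost_iff le_less_trans)
  then show ?thesis by (simp add: arc_vertices_def card_image)
qed

lemma arc_edges_subset: "0 < l \<Longrightarrow> arc_edges l a j \<subseteq> cycle_edges l"
proof
  fix e assume "0 < l" "e \<in> arc_edges l a j"
  then obtain i where "e = {(a + i) mod l, Suc (a + i) mod l}" by (auto simp: arc_edges_def)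
  then have "e = {(a + i) mod l, ((a + i) mod l + 1) mod l}" by (simp add: mod_Suc_eq)
  moreover have "(a + i) mod l < l" using \<open>0 < l\<close> by simp
  ultimately show "e \<in> cycle_edges l" unfolding cycle_edges_def by blast
qed

lemma grown_tree_arc:
  assumes "j < l"
  shows "grown_tree (arc_vertices l a j) (arc_edges l a j)"
  using assms
proof (induction j)
  case 0
  show ?case by (simp add: arc_vertices_def arc_edges_def grown_tree.single)
next
  case (Suc j)
  have "Suc (a + j) mod l \<notin> arc_vertices l a j"
  proof
    assume "Suc (a + j) mod l \<in> arc_vertices l a j"
    then have "arc_vertices l a (Suc j) = arc_vertices l a j"
      by (simp add: arc_vertices_Suc insert_absorb)
    then show False using card_arc_vertices[OF Suc.prems, of a] card_arc_vertices[of j l a] Suc.prems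
      by simp
  qed
  moreover have "(a + j) mod l \<in> arc_vertices l a j" by (auto simp: arc_vertices_def)
  ultimately show ?case
    using Suc grown_tree.leaf unfolding arc_vertices_Suc arc_edges_Suc by (metis Suc_lessD)
qed

text \<open>Both cyclic neighbours of an inner vertex of an arc are already in the arc, so a new
  leaf can only be attached at an end: forwards with the same start, or backwards with
  \<open>w\<close> as the new start.\<close>

lemma grown_tree_in_cycle_is_arc:
  assumes "3 \<le> l" "grown_tree V E" "V \<subseteq> {0..<l}" "E \<subseteq> cycle_edges l"
  shows "\<exists>a<l. \<exists>j. V = arc_vertices l a j \<and> E = arc_edges l a j"
  using assms(2-4)
proof induction
  case (single v)
  then show ?case
    by (intro exI[of _ v] conjI exI[of _ 0]) (auto simp: arc_vertices_def arc_edges_def)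
next
  case (leaf V E u w)
  then obtain a j where a: "a < l" "V = arc_vertices l a j" "E = arc_edges l a j" by auto
  obtain i where i: "i \<le> j" "u = (a + i) mod l"
    using leaf.hyps(2) a(2) by (auto simp: arc_vertices_def)
  have w: "w < l" and u: "u < l" using leaf by auto
  have "{u, w} \<in> cycle_edges l" using leaf.prems by simp
  then consider "w = Suc u mod l" | "u = Suc w mod l"
    unfolding cycle_edges_def by (auto simp: doubleton_eq_iff)
  then show ?case
  proof cases
    case 1
    have w': "w = Suc (a + i) mod l" using 1 i by (simp add: mod_Suc_eq)
    have "i = j"
    proof (rule ccontr)
      assume "i \<noteq> j"
      then have "w \<in> V" unfolding a(2) arc_vertices_def w' using i
        by (intro image_eqI[of _ _ "Suc i"]) auto
      then show False using leaf.hyps(3) by simp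
    qed
    then show ?thesis using a i w' by (intro exI[of _ a] conjI exI[of _ "Suc j"])
        (simp_all add: arc_vertices_Suc arc_edges_Suc)
  next
    case 2
    have "i = 0"
    proof (rule ccontr)
      assume "i \<noteq> 0"
      then obtain i' where i': "i = Suc i'" by (cases i) auto
      have "Suc w mod l = Suc (a + i') mod l" using 2 i i' by simp
      then have "w mod l = (a + i') mod l"
        by (metis mod_Suc mod_less nat.inject mod_Suc_eq  old.nat.distinct(1))
      then have "w \<in> V" unfolding a(2) arc_vertices_def using i i' w
        by (intro image_eqI[of _ _ i']) auto
      then show False using leaf.hyps(3) by simp
    qed
    then have au: "a = Suc w mod l" using 2 i a by simp
    then show ?thesis using w a 2 by (intro exI[of _ w] conjI exI[of _ "Suc j"])
        (simp_all add: arc_vertices_Suc_start arc_edges_Suc_start insert_commute)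
  qed
qed

text \<open>The start of a proper arc is the only index in it whose cyclic predecessor is missing.
  Edges are used instead of vertices because all arcs with \<open>l - 1\<close> edges have the same
  vertex set.\<close>

lemma arc_edges_inj:
  assumes "3 \<le> l" "0 < j" "j < l" "a < l" "b < l" "arc_edges l a j = arc_edges l b j"
  shows "a = b"
proof (rule ccontr)
  assume "a \<noteq> b"
  let ?e = "\<lambda>i. {i, Suc i mod l}"
  define I where "I c = (\<lambda>i. (c + i) mod l) ` {..<j}" for c
  have "arc_edges l c j = ?e ` I c" for c
    unfolding arc_edges_def I_def image_image by (simp add: mod_Suc_eq)
  moreover have "I c \<subseteq> {0..<l}" for c using assms(1) by (auto simp: I_def)
  ultimately have I: "I a = I b"
    using assms(6) inj_on_image_eq_iff[OF cycle_edge_inj[OF assms(1)], of "I a" "I b"] by simp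
  have "a \<in> I a" unfolding I_def using assms(2,4) by (intro image_eqI[of _ _ 0]) auto
  then obtain i where i: "i < j" "a = (b + i) mod l" using I by (auto simp: I_def)
  then have "i \<noteq> 0" using \<open>a \<noteq> b\<close> assms(5) by (cases i) auto
  then obtain i1 where i1: "i = Suc i1" by (cases i) auto
  have "(b + i1) mod l \<in> I b" unfolding I_def using i i1 by auto
  then obtain i' where i': "i' < j" "(b + i1) mod l = (a + i') mod l" using I by (auto simp: I_def)
  have "(a + 0) mod l = Suc (b + i1) mod l" using i i1 by simp
  also have "\<dots> = Suc ((b + i1) mod l) mod l" by (simp add: mod_Suc_eq)
  also have "\<dots> = (a + Suc i') mod l" unfolding i'(2) by (simp add: mod_Suc_eq)
  finally have "0 = Suc i'" by (rule mod_shift_inj[rotated 2]) (use i' assms(3) in auto)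
  then show False by simp
qed

text \<open>Extending an arc by one edge at its end keeps its start, so arcs with a prescribed vertex are
  at least as numerous when they are longer.\<close>

lemma nsub_over_cycle_mono:
  assumes "3 \<le> l" "Suc k \<le> l"
  shows "nsub_over k {0..<l} (cycle_edges l) {0} \<le> nsub_over (Suc k) {0..<l} (cycle_edges l) {0}"
proof (cases k)
  case 0
  then show ?thesis using nsub_over_0[OF graph_cycle_edges[OF assms(1)]] by simp
next
  case (Suc j)
  note g = graph_cycle_edges[OF assms(1)]
  let ?S = "\<lambda>k. subtrees_over k {0..<l} (cycle_edges l) {0}"
  let ?arc = "\<lambda>j a. (arc_vertices l a j, arc_edges l a j)"
  \<comment> \<open>The starts of arcs with \<open>j\<close> edges through 0. Since \<open>k\<close>
    is \<open>Suc j\<close>, subtrees with \<open>k\<close> vertices belong to \<open>A j\<close>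
    and those with \<open>Suc k\<close> vertices to \<open>A k\<close>.\<close>
  define A where "A j = {a. a < l \<and> 0 \<in> arc_vertices l a j}" for j
  have fin: "finite (A j)" for j by (simp add: A_def)
  have "?S k \<subseteq> ?arc j ` A j"
  proof
    fix T assume "T \<in> ?S k"
    then obtain V E where T: "T = (V, E)" "V \<subseteq> {0..<l}" "E \<subseteq> cycle_edges l" "grown_tree V E"
      "card V = k" "0 \<in> V" by (auto simp: subtrees_over_def)
    then obtain a j' where a: "a < l" "V = arc_vertices l a j'" "E = arc_edges l a j'"
      using grown_tree_in_cycle_is_arc[OF assms(1)] by metis
    have "j' = j"
    proof (cases "j' < l")
      case True
      then show ?thesis using card_arc_vertices[OF True] a(2) T(5) Suc by simp
    next
      case False
      \<comment> \<open>An arc that wraps around covers all \<open>l\<close> vertices, more than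
        \<open>k\<close>.\<close>
      then have "arc_vertices l a (l - 1) \<subseteq> V" unfolding a(2) arc_vertices_def by auto
      then have "card (arc_vertices l a (l - 1)) \<le> k"
        using card_mono[OF finite_subset[OF T(2)], of "arc_vertices l a (l - 1)"] T(5) by simp
      then show ?thesis using card_arc_vertices[of "l - 1" l a] assms by simp
    qed
    then show "T \<in> ?arc j ` A j" using a T(1,6) by (auto simp: A_def)
  qed
  then have "card (?S k) \<le> card (A j)" by (rule surj_card_le[OF fin])
  also have "\<dots> \<le> card (A k)"
    by (rule card_mono[OF fin]) (auto simp: A_def arc_vertices_Suc Suc)
  also have "\<dots> \<le> card (?S (Suc k))"
  proof (rule card_inj_on_le[OF _ _ finite_subtrees_over[OF g]])
    show "inj_on (?arc k) (A k)"
      using arc_edges_inj[OF assms(1), of k] assms(2) Suc by (auto simp: inj_on_def A_def)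
    show "?arc k ` A k \<subseteq> ?S (Suc k)"
    proof clarify
      fix a assume "a \<in> A k"
      moreover have "arc_vertices l a k \<subseteq> {0..<l}" using assms by (auto simp: arc_vertices_def)
      ultimately show "?arc k a \<in> ?S (Suc k)"
        using assms grown_tree_arc[of k l a] card_arc_vertices[of k l a] arc_edges_subset[of l a k]
        by (simp add: subtrees_over_def A_def)
    qed
  qed
  finally show ?thesis by (simp add: nsub_over_def)
qed

lemma nsub_over_is_cycle:
  assumes "is_cycle C" "v \<in> \<Union>C"
  defines "l \<equiv> card (\<Union>C)"
  shows "nsub_over k (\<Union>C) C {v} = nsub_over k {0..<l} (cycle_edges l) {0}"
    "nsub_over k (\<Union>C) C {} = nsub_over k {0..<l} (cycle_edges l) {}"
proof -
  have l: "3 \<le> l" using assms(1) by (simp add: is_cycle_def l_def)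
  obtain f where f: "inj_on f {0..<l}" "f 0 = v" "f ` {0..<l} = \<Union>C" "(`) f ` cycle_edges l = C"
    using cycle_enumeration[OF assms(1,2)] unfolding l_def by metis
  note image = nsub_over_image[OF graph_cycle_edges[OF l] f(1)]
  show "nsub_over k (\<Union>C) C {v} = nsub_over k {0..<l} (cycle_edges l) {0}"
    using image[of "{0}" k] f l by simp
  show "nsub_over k (\<Union>C) C {} = nsub_over k {0..<l} (cycle_edges l) {}"
    using image[of "{}" k] f by simp
qed

section \<open>The extremal graphs\<close>

lemma US_base: "US_E l l = cycle_edges l"
  by (auto simp: US_E_def)

lemma US_Suc:
  assumes "l \<le> n"
  shows "US_V (Suc n) l = insert n (US_V n l)" "US_E (Suc n) l = insert {0, n} (US_E n l)"
  using assms by (auto simp: US_V_def US_E_def less_Suc_eq)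

text \<open>For \<open>n = l\<close> there is no tail, and the cycle vertex 0 to which the tail will
  be attached serves as its end.\<close>

definition UP_end :: "nat \<Rightarrow> nat \<Rightarrow> nat" where
  "UP_end n l = (if n = l then 0 else n - 1)"

lemma UP_base: "UP_E l l = cycle_edges l"
  by (auto simp: UP_E_def)

lemma UP_Suc:
  assumes "l \<le> n"
  shows "UP_V (Suc n) l = insert n (UP_V n l)" "UP_E (Suc n) l = insert {UP_end n l, n} (UP_E n l)"
proof -
  show "UP_V (Suc n) l = insert n (UP_V n l)" by (auto simp: UP_V_def)
  show "UP_E (Suc n) l = insert {UP_end n l, n} (UP_E n l)"
  proof (cases "n = l")
    case True
    then show ?thesis by (auto simp: UP_E_def UP_end_def)
  next
    case False
    then obtain m where "n = Suc m" "l \<le> m" using assms by (cases n) auto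
    then show ?thesis by (auto simp: UP_E_def UP_end_def less_Suc_eq)
  qed
qed

lemma UP_end_Suc: "l \<le> n \<Longrightarrow> UP_end (Suc n) l = n"
  by (simp add: UP_end_def)

lemma UP_end_in: "3 \<le> l \<Longrightarrow> l \<le> n \<Longrightarrow> UP_end n l \<in> UP_V n l"
  by (auto simp: UP_end_def UP_V_def)

lemma graph_US:
  assumes "3 \<le> l" "l \<le> n"
  shows "graph (US_V n l) (US_E n l)"
  using assms(2)
proof (induction n rule: dec_induct)
  case base
  show ?case using graph_cycle_edges[OF assms(1)] by (simp add: US_base US_V_def)
next
  case (step n)
  then show ?case unfolding US_Suc[OF step(1)]
    by (intro graph_insert_leaf) (use assms in \<open>auto simp: US_V_def\<close>)
qed

lemma graph_UP:
  assumes "3 \<le> l" "l \<le> n"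
  shows "graph (UP_V n l) (UP_E n l)"
  using assms(2)
proof (induction n rule: dec_induct)
  case base
  show ?case using graph_cycle_edges[OF assms(1)] by (simp add: UP_base UP_V_def)
next
  case (step n)
  then show ?case unfolding UP_Suc[OF step(1)]
    by (intro graph_insert_leaf UP_end_in[OF assms(1)]) (auto simp: UP_V_def)
qed

text \<open>Lengthening the tail shifts the sequence of counts at its end by one place.\<close>

lemma nsub_over_UP_Suc:
  assumes "3 \<le> l" "l \<le> n"
  shows "nsub_over (Suc k) (UP_V (Suc n) l) (UP_E (Suc n) l) {UP_end (Suc n) l} =
    (if k = 0 then 1 else nsub_over k (UP_V n l) (UP_E n l) {UP_end n l})"
  unfolding UP_Suc[OF assms(2)] UP_end_Suc[OF assms(2)]
  by (rule nsub_over_leaf[OF graph_UP UP_end_in]) (use assms in \<open>auto simp: UP_V_def\<close>)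

text \<open>Each shift inserts a 1 at position 1 in front of a sequence that itself starts with 1
  there, so monotonicity is inherited from the cycle. The bound on \<open>k\<close> matters: the
  count drops to 0 beyond \<open>n\<close>.\<close>

lemma nsub_over_UP_mono:
  assumes "3 \<le> l" "l \<le> n" "Suc k \<le> n"
  shows "nsub_over k (UP_V n l) (UP_E n l) {UP_end n l} \<le> nsub_over (Suc k) (UP_V n l) (UP_E n l) {UP_end n l}"
  using assms(2,3)
proof (induction n arbitrary: k rule: dec_induct)
  case base
  then show ?case using nsub_over_cycle_mono[OF assms(1)] by (simp add: UP_base UP_V_def UP_end_def)
next
  case (step n)
  show ?case
  proof (cases k)
    case 0
    then show ?thesis using nsub_over_0[OF graph_UP[OF assms(1)]] step(1) by simp
  next
    case (Suc j)
    have 1: "nsub_over (Suc 0) (UP_V n l) (UP_E n l) {UP_end n l} = 1"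
      by (rule nsub_over_1[OF UP_end_in[OF assms(1) step(1)]])
    show ?thesis unfolding Suc nsub_over_UP_Suc[OF assms(1) step(1)]
      using step.IH[of j] step.prems Suc 1 by auto
  qed
qed

section \<open>Growing a unicyclic graph leaf by leaf\<close>

lemma grown_unicyclic_basic:
  assumes "grown_unicyclic l V E"
  shows "graph V E \<and> 3 \<le> l \<and> l \<le> card V"
  using assms
proof induction
  case (cycle C)
  then show ?case by (auto simp: is_cycle_def)
next
  case (leaf V E u w)
  then have "card (insert w V) = Suc (card V)" by (simp add: graph_def)
  then show ?case using leaf graph_insert_leaf[of V E u w] by linarith
qed

text \<open>At the centre of the star-like graph the new count is the old count for \<open>k\<close>
  plus the old count for \<open>k - 1\<close>, as every new leaf hangs on the centre. For any other
  graph the subtrees through both \<open>u\<close> and \<open>v\<close> are at most those through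
  \<open>u\<close>, so the same sum is an upper bound.\<close>

lemma nsub_over_le_US:
  assumes "grown_unicyclic l V E" "v \<in> V"
  shows "nsub_over k V E {v} \<le> nsub_over k (US_V (card V) l) (US_E (card V) l) {0}"
  using assms
proof (induction arbitrary: v k)
  case (cycle C)
  then show ?case using nsub_over_is_cycle(1)[OF cycle(1), of v k] by (simp add: US_base US_V_def)
next
  case (leaf V E u w)
  note basic = grown_unicyclic_basic[OF leaf(1)]
  let ?n = "card V"
  have g: "graph V E" and l: "3 \<le> l" "l \<le> ?n" using basic by auto
  have n: "card (insert w V) = Suc ?n" using g leaf(3) by (simp add: graph_def)
  have US: "graph (US_V ?n l) (US_E ?n l)" "0 \<in> US_V ?n l" "?n \<notin> US_V ?n l"
    using graph_US[OF l] l by (auto simp: US_V_def)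
  show ?case
  proof (cases k)
    case 0
    have "graph (insert w V) (insert {u, w} E)" using g leaf(2,3) by (rule graph_insert_leaf)
    then show ?thesis using 0 by (simp add: nsub_over_0)
  next
    case k: (Suc k')
    show ?thesis
    proof (cases "k' = 0")
      case True
      have "0 \<in> insert ?n (US_V ?n l)" using US by simp
      then show ?thesis unfolding k True n US_Suc[OF l(2)]
        using nsub_over_1[OF leaf(5)] nsub_over_1 by (metis order_refl)
    next
      case False
      have *: "nsub_over k (US_V (Suc ?n) l) (US_E (Suc ?n) l) {0} =
          nsub_over k (US_V ?n l) (US_E ?n l) {0} + nsub_over k' (US_V ?n l) (US_E ?n l) {0}"
        unfolding k US_Suc[OF l(2)] using nsub_over_insert_leaf[OF US US(2) False] by simp
      show ?thesis
      proof (cases "v = w")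
        case True
        then show ?thesis unfolding n *
          using nsub_over_leaf[OF g leaf(2,3), of k'] False leaf.IH[OF leaf(2), of k'] k by simp
      next
        case vw: False
        then have v: "v \<in> V" using leaf.prems by simp
        have "nsub_over k (insert w V) (insert {u, w} E) {v} = nsub_over k V E {v} + nsub_over k' V E {u, v}"
          unfolding k by (rule nsub_over_insert_leaf[OF g leaf(2,3) v False])
        also have "nsub_over k' V E {u, v} \<le> nsub_over k' V E {u}"
          by (rule nsub_over_antimono[OF g]) simp
        finally show ?thesis unfolding n *
          using leaf.IH[OF v, of k] leaf.IH[OF leaf(2), of k'] by linarith
      qed
    qed
  qed
qed

text \<open>The count at the new end of the tail equals the old count for \<open>k'\<close>. For
  \<open>v = w\<close> the induction hypothesis at \<open>u\<close> is enough; for an old vertex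
  \<open>v\<close> one of the two summands for \<open>v\<close> already suffices, which one
  depending on the size of \<open>k'\<close>.\<close>

lemma UP_le_nsub_over:
  assumes "grown_unicyclic l V E" "v \<in> V"
  shows "nsub_over k (UP_V (card V) l) (UP_E (card V) l) {UP_end (card V) l} \<le> nsub_over k V E {v}"
  using assms
proof (induction arbitrary: v k)
  case (cycle C)
  then show ?case using nsub_over_is_cycle(1)[OF cycle(1), of v k]
    by (simp add: UP_base UP_V_def UP_end_def)
next
  case (leaf V E u w)
  note basic = grown_unicyclic_basic[OF leaf(1)]
  let ?n = "card V"
  let ?p = "\<lambda>k. nsub_over k (UP_V ?n l) (UP_E ?n l) {UP_end ?n l}"
  have g: "graph V E" and l: "3 \<le> l" "l \<le> ?n" using basic by auto
  have n: "card (insert w V) = Suc ?n" using g leaf(3) by (simp add: graph_def)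
  show ?case
  proof (cases k)
    case 0
    have "graph (UP_V (Suc ?n) l) (UP_E (Suc ?n) l)" using l by (simp add: graph_UP)
    then show ?thesis using 0 n by (simp add: nsub_over_0)
  next
    case k: (Suc k')
    note p = nsub_over_UP_Suc[OF l, of k']
    show ?thesis
    proof (cases "k' = 0")
      case True
      then show ?thesis using p nsub_over_1[OF leaf.prems, of "insert {u, w} E"] k n by simp
    next
      case False
      show ?thesis
      proof (cases "v = w")
        case True
        then show ?thesis unfolding n k p
          using nsub_over_leaf[OF g leaf(2,3), of k'] False leaf.IH[OF leaf(2), of k'] by simp
      next
        case vw: False
        then have v: "v \<in> V" using leaf.prems by simp
        have split: "nsub_over k (insert w V) (insert {u, w} E) {v} =
            nsub_over k V E {v} + nsub_over k' V E {u, v}"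
          unfolding k by (rule nsub_over_insert_leaf[OF g leaf(2,3) v False])
        consider "k \<le> ?n" | "k' = ?n" | "?n < k'" using k by linarith
        then have "?p k' \<le> nsub_over k (insert w V) (insert {u, w} E) {v}"
        proof cases
          case 1
          \<comment> \<open>Monotonicity moves from \<open>k'\<close> to \<open>k\<close>, where the
            subtrees avoiding \<open>w\<close> are enough.\<close>
          then have "?p k' \<le> ?p k" unfolding k by (intro nsub_over_UP_mono[OF l]) simp
          also have "\<dots> \<le> nsub_over k V E {v}" by (rule leaf.IH[OF v])
          finally show ?thesis using split by simp
        next
          case 2
          \<comment> \<open>Monotonicity fails at this size, but subtrees of \<open>V\<close> with
            \<open>k'\<close> vertices are spanning, so all of them extend to
            \<open>w\<close>.\<close>
          have "nsub_over k' V E {u, v} = nsub_over k' V E {v}"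
            using nsub_over_card[OF g, of "{u, v}"] nsub_over_card[OF g, of "{v}"] leaf(2) v 2 by simp
          then show ?thesis using leaf.IH[OF v, of k'] split by simp
        next
          case 3
          then show ?thesis using nsub_over_gt_card[OF graph_UP[OF l], of k'] by (simp add: UP_V_def)
        qed
        then show ?thesis unfolding n k p using False by simp
      qed
    qed
  qed
qed

text \<open>All three graphs grow by a leaf simultaneously. The gain is the number of smaller
  subtrees through the attachment vertex, which is \<open>u\<close>, 0 or the end of the tail, and
  these numbers have just been compared.\<close>

lemma nsub_between_UP_and_US:
  assumes "grown_unicyclic l V E"
  shows "nsub_over k V E {} \<le> nsub_over k (US_V (card V) l) (US_E (card V) l) {}
    \<and> nsub_over k (UP_V (card V) l) (UP_E (card V) l) {} \<le> nsub_over k V E {}"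
  using assms
proof induction
  case (cycle C)
  have "3 \<le> card (\<Union>C)" using cycle by (simp add: is_cycle_def)
  then obtain v where "v \<in> \<Union>C" by (metis all_not_in_conv card.empty not_numeral_le_zero)
  then show ?case using nsub_over_is_cycle(2)[OF cycle(1), of v k] cycle(2)
    by (simp add: US_base US_V_def UP_base UP_V_def)
next
  case (leaf V E u w)
  note basic = grown_unicyclic_basic[OF leaf(1)]
  let ?n = "card V"
  have g: "graph V E" and l: "3 \<le> l" "l \<le> ?n" using basic by auto
  have n: "card (insert w V) = Suc ?n" using g leaf(3) by (simp add: graph_def)
  have US: "graph (US_V ?n l) (US_E ?n l)" "0 \<in> US_V ?n l" "?n \<notin> US_V ?n l"
    using graph_US[OF l] l by (auto simp: US_V_def)
  have UP: "graph (UP_V ?n l) (UP_E ?n l)" "UP_end ?n l \<in> UP_V ?n l" "?n \<notin> UP_V ?n l"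
    using graph_UP[OF l] UP_end_in[OF l] by (auto simp: UP_V_def)
  show ?case
  proof (cases k)
    case 0
    then show ?thesis unfolding n US_Suc[OF l(2)] UP_Suc[OF l(2)]
      using nsub_over_0[OF graph_insert_leaf[OF g leaf(2,3)]]
        nsub_over_0[OF graph_insert_leaf[OF US]] nsub_over_0[OF graph_insert_leaf[OF UP]] by simp
  next
    case k: (Suc k')
    show ?thesis
      unfolding n US_Suc[OF l(2)] UP_Suc[OF l(2)]
        nsub_over_split_leaf[OF g leaf(2,3) empty_subsetI]
        nsub_over_split_leaf[OF US empty_subsetI] nsub_over_split_leaf[OF UP empty_subsetI]
      unfolding k nsub_over_leaf[OF g leaf(2,3)] nsub_over_leaf[OF US] nsub_over_leaf[OF UP]
      using leaf.IH nsub_over_le_US[OF leaf(1,2), of k'] UP_le_nsub_over[OF leaf(1,2), of k'] k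
      by (auto intro: add_mono)
  qed
qed

theorem theorem10:
  fixes V :: "'a set" and E :: "'a set set" and n l :: nat
  assumes "3 \<le> l" and "l \<le> n"
    and "unicyclic V E" and "card V = n" and "has_girth V E l"
  shows "\<forall>k. nsub k (US_V n l) (US_E n l) \<ge> nsub k V E \<and> nsub k V E \<ge> nsub k (UP_V n l) (UP_E n l)"
proof -
  obtain C where "cycles V E = {C}" "card C = l" using assms(5) by (auto simp: has_girth_def)
  then have "grown_unicyclic l V E"
    using grown_unicyclic_if_one_cycle assms(3) by (auto simp: unicyclic_def)
  \<comment> \<open>For \<open>k = 0\<close> all three values are 1 by convention.\<close>
  from nsub_between_UP_and_US[OF this] show ?thesis
    using assms(4) by (simp add: nsub_eq_nsub_over)
qed

end
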